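(* Let $A,B,C>0$ be operators on a complex Hilbert space $\mathcal{H}$ and let $\alpha\in(0,1)$. Then $C\leq A!_{\alpha}B$ if and only if $$\begin{bmatrix}\alpha A & 2\alpha(1-\alpha)C\\ 2\alpha(1-\alpha)C & (1-\alpha)B\end{bmatrix}\geq \alpha(1-\alpha)\begin{bmatrix}C&C\\ C&C\end{bmatrix}.$$
   Context: Operators are bounded linear operators on a complex Hilbert space $\mathcal{H}$; the $2\times2$ operator matrices act on $\mathcal{H}\oplus\mathcal{H}$. $A\ge 0$ means $\langle Ax,x\rangle\ge 0$ for all $x$; $A>0$ means $A$ is positive and invertible; for self-adjoint $A,B$, $A\le B$ means $B-A\ge 0$. For $A,B>0$, the $\alpha$-weighted harmonic mean is $A!_\alpha B=\bigl((1-\alpha)A^{-1}+\alpha B^{-1}\bigr)^{-1}$. *)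

theory Defs
  imports "HOL-Analysis.Analysis" "HOL-Library.Nonpos_Ints"
begin

section \<open>Complex Hilbert spaces\<close>

text \<open>
  The real normed structure of a complex inner product space is the one induced by its complex
  structure: real scaling is the restriction of complex scaling and the norm comes from the inner
  product. Building on \<^class>\<open>real_normed_vector\<close> therefore excludes no complex inner product space,
  and it gives access to the library's bounded linear operators. The inner product is linear in its
  first argument.
\<close>

class complex_inner = real_normed_vector +
  fixes scaleC :: "complex \<Rightarrow> 'a \<Rightarrow> 'a"  (infixr "*\<^sub>C" 75)
    and cinner :: "'a \<Rightarrow> 'a \<Rightarrow> complex"
  assumes scaleC_add_right: "c *\<^sub>C (x + y) = c *\<^sub>C x + c *\<^sub>C y"
    and scaleC_add_left: "(c + d) *\<^sub>C x = c *\<^sub>C x + d *\<^sub>C x"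
    and scaleC_scaleC: "c *\<^sub>C (d *\<^sub>C x) = (c * d) *\<^sub>C x"
    and scaleR_eq_scaleC: "r *\<^sub>R x = complex_of_real r *\<^sub>C x"
    and cinner_commute: "cinner x y = cnj (cinner y x)"
    and cinner_add_left: "cinner (x + y) z = cinner x z + cinner y z"
    and cinner_scaleC_left: "cinner (c *\<^sub>C x) y = c * cinner x y"
    and cinner_self_nonneg: "cinner x x \<in> \<real>\<^sub>\<ge>\<^sub>0"
    and cinner_eq_zero_iff: "cinner x x = 0 \<longleftrightarrow> x = 0"
    and norm_eq_sqrt_cinner: "norm x = sqrt (Re (cinner x x))"

class chilbert_space = complex_inner + complete_space

text \<open>
  The orthogonal direct sum of two Hilbert spaces is the product type; the library's product norm is
  already the Hilbert space norm.
\<close>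

instantiation prod :: (complex_inner, complex_inner) complex_inner
begin

definition scaleC_prod_def: "c *\<^sub>C p = (c *\<^sub>C fst p, c *\<^sub>C snd p)"

definition cinner_prod_def: "cinner p q = cinner (fst p) (fst q) + cinner (snd p) (snd q)"

instance
proof
  fix p q s :: "'a \<times> 'b" and c d :: complex and r :: real
  show "c *\<^sub>C (p + q) = c *\<^sub>C p + c *\<^sub>C q"
    by (simp add: scaleC_prod_def scaleC_add_right)
  show "(c + d) *\<^sub>C p = c *\<^sub>C p + d *\<^sub>C p"
    by (simp add: scaleC_prod_def scaleC_add_left)
  show "c *\<^sub>C (d *\<^sub>C p) = (c * d) *\<^sub>C p"
    by (simp add: scaleC_prod_def scaleC_scaleC)
  show "r *\<^sub>R p = complex_of_real r *\<^sub>C p"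
    by (simp add: scaleC_prod_def scaleR_prod_def scaleR_eq_scaleC)
  show "cinner p q = cnj (cinner q p)"
    by (simp add: cinner_prod_def cinner_commute[symmetric])
  show "cinner (p + q) s = cinner p s + cinner q s"
    by (simp add: cinner_prod_def cinner_add_left)
  show "cinner (c *\<^sub>C p) q = c * cinner p q"
    by (simp add: cinner_prod_def scaleC_prod_def cinner_scaleC_left distrib_left)
  show "cinner p p \<in> \<real>\<^sub>\<ge>\<^sub>0"
    by (simp add: cinner_prod_def cinner_self_nonneg nonneg_Reals_add_I)
  have nn: "Re (cinner x x) \<ge> 0" for x :: "'c::complex_inner"
    using cinner_self_nonneg[of x] by (simp add: complex_nonneg_Reals_iff)
  have im: "Im (cinner x x) = 0" for x :: "'c::complex_inner"
    using cinner_self_nonneg[of x] by (simp add: complex_nonneg_Reals_iff)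
  show "cinner p p = 0 \<longleftrightarrow> p = 0"
  proof
    assume "cinner p p = 0"
    then have "Re (cinner (fst p) (fst p)) + Re (cinner (snd p) (snd p)) = 0"
      by (metis cinner_prod_def plus_complex.sel(1) zero_complex.sel(1))
    then have "Re (cinner (fst p) (fst p)) = 0" "Re (cinner (snd p) (snd p)) = 0"
      using nn[of "fst p"] nn[of "snd p"] by linarith+
    then have "cinner (fst p) (fst p) = 0" "cinner (snd p) (snd p) = 0"
      using im by (simp_all add: complex_eq_iff)
    then show "p = 0"
      by (simp add: cinner_eq_zero_iff prod_eq_iff)
  next
    assume "p = 0"
    then show "cinner p p = 0"
      using cinner_eq_zero_iff[of "0::'a"] cinner_eq_zero_iff[of "0::'b"]
      by (simp add: cinner_prod_def)
  qed
  show "norm p = sqrt (Re (cinner p p))"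
    using nn[of "fst p"] nn[of "snd p"]
    by (simp add: norm_prod_def cinner_prod_def norm_eq_sqrt_cinner)
qed

end

instance prod :: (chilbert_space, chilbert_space) chilbert_space ..


section \<open>Operators\<close>

text \<open>
  An operator is an element of the library type of bounded (real-)linear maps that is moreover
  complex-linear.
\<close>

definition is_operator :: "('a::complex_inner \<Rightarrow>\<^sub>L 'b::complex_inner) \<Rightarrow> bool" where
  "is_operator T \<longleftrightarrow> (\<forall>c x. T (c *\<^sub>C x) = c *\<^sub>C T x)"

definition is_inverse_op :: "('a::complex_inner \<Rightarrow>\<^sub>L 'a) \<Rightarrow> ('a \<Rightarrow>\<^sub>L 'a) \<Rightarrow> bool" where
  "is_inverse_op T S \<longleftrightarrow>
     is_operator S \<and> T o\<^sub>L S = id_blinfun \<and> S o\<^sub>L T = id_blinfun"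

definition invertible_op :: "('a::complex_inner \<Rightarrow>\<^sub>L 'a) \<Rightarrow> bool" where
  "invertible_op T \<longleftrightarrow> (\<exists>S. is_inverse_op T S)"

text \<open>Meaningful for invertible operators only.\<close>

definition inverse_op :: "('a::complex_inner \<Rightarrow>\<^sub>L 'a) \<Rightarrow> ('a \<Rightarrow>\<^sub>L 'a)" where
  "inverse_op T = (THE S. is_inverse_op T S)"

lemma is_inverse_op_unique:
  assumes "is_inverse_op T S" and "is_inverse_op T S'"
  shows "S = S'"
proof (rule blinfun_eqI)
  fix x
  have "T (S' x) = x" and "S (T (S' x)) = S' x"
    using assms unfolding is_inverse_op_def
    by (metis blinfun_apply_blinfun_compose blinfun_apply_id_blinfun)+
  then show "S x = S' x" by simp
qed

lemma is_inverse_op_inverse_op: "invertible_op T \<Longrightarrow> is_inverse_op T (inverse_op T)"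
  unfolding invertible_op_def inverse_op_def
  by (metis is_inverse_op_unique theI)

text \<open>Membership in the nonnegative reals includes that the complex number is real.\<close>

definition positive_op :: "('a::complex_inner \<Rightarrow>\<^sub>L 'a) \<Rightarrow> bool" where
  "positive_op T \<longleftrightarrow> (\<forall>x. cinner (T x) x \<in> \<real>\<^sub>\<ge>\<^sub>0)"

definition strictly_positive_op :: "('a::complex_inner \<Rightarrow>\<^sub>L 'a) \<Rightarrow> bool" where
  "strictly_positive_op T \<longleftrightarrow> positive_op T \<and> invertible_op T"

text \<open>The order is intended for self-adjoint operators; positive operators are self-adjoint.\<close>

definition loewner_le :: "('a::complex_inner \<Rightarrow>\<^sub>L 'a) \<Rightarrow> ('a \<Rightarrow>\<^sub>L 'a) \<Rightarrow> bool"  (infix "\<preceq>" 50) where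
  "S \<preceq> T \<longleftrightarrow> positive_op (T - S)"

definition weighted_harmonic_mean ::
    "real \<Rightarrow> ('a::complex_inner \<Rightarrow>\<^sub>L 'a) \<Rightarrow> ('a \<Rightarrow>\<^sub>L 'a) \<Rightarrow> ('a \<Rightarrow>\<^sub>L 'a)" where
  "weighted_harmonic_mean \<alpha> A B =
     inverse_op ((1 - \<alpha>) *\<^sub>R inverse_op A + \<alpha> *\<^sub>R inverse_op B)"

definition op_matrix ::
    "('a::complex_inner \<Rightarrow>\<^sub>L 'a) \<Rightarrow> ('a \<Rightarrow>\<^sub>L 'a) \<Rightarrow> ('a \<Rightarrow>\<^sub>L 'a) \<Rightarrow> ('a \<Rightarrow>\<^sub>L 'a) \<Rightarrow>
     (('a \<times> 'a) \<Rightarrow>\<^sub>L ('a \<times> 'a))" where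
  "op_matrix P Q R S = Blinfun (\<lambda>p. (P (fst p) + Q (snd p), R (fst p) + S (snd p)))"

lemma op_matrix_apply:
  "op_matrix P Q R S (x, y) = (P x + Q y, R x + S y)"
proof -
  have "bounded_linear (\<lambda>p. (P (fst p) + Q (snd p), R (fst p) + S (snd p)))"
    by (intro bounded_linear_Pair bounded_linear_add
          bounded_linear_compose[OF blinfun.bounded_linear_right]
          bounded_linear_fst bounded_linear_snd)
  then show ?thesis
    by (simp add: op_matrix_def bounded_linear_Blinfun_apply)
qed

end

theory Submission imports Defs begin

text \<open>
  Write \<open>\<beta> = 1 - \<alpha>\<close>. Subtracting the right-hand matrix from the left-hand one leaves an operator
  whose quadratic form at \<open>(x, y)\<close> is
  \<open>\<alpha>\<langle>Ax, x\<rangle> + \<beta>\<langle>By, y\<rangle> - \<alpha>\<beta>\<langle>C(x - y), x - y\<rangle>\<close>.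
  So the matrix inequality says that \<open>\<alpha>\<beta>\<langle>Cz, z\<rangle>\<close> is at most \<open>\<alpha>\<langle>Ax, x\<rangle> + \<beta>\<langle>By, y\<rangle>\<close> whenever
  \<open>x - y = z\<close>. For fixed \<open>z\<close> the minimum of the latter is \<open>\<alpha>\<beta>\<langle>Hz, z\<rangle>\<close>, where \<open>H\<close> is the weighted
  harmonic mean: this is the variational description of the harmonic mean (as a parallel sum), and
  it gives the equivalence.

  The minimum is found by completing the square (\<open>harmonic_mean_complete_square\<close>). With
  \<open>w = Hz\<close>, the minimiser is \<open>x\<^sub>0 = \<beta>A\<inverse>w\<close>, \<open>y\<^sub>0 = -\<alpha>B\<inverse>w\<close>; indeed
  \<open>x\<^sub>0 - y\<^sub>0 = (\<beta>A\<inverse> + \<alpha>B\<inverse>)w = z\<close>. Any other admissible pair is \<open>(x\<^sub>0 + d, y\<^sub>0 + d)\<close> and exceeds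
  the minimum by exactly \<open>\<alpha>\<langle>Ad, d\<rangle> + \<beta>\<langle>Bd, d\<rangle> \<ge> 0\<close>.

  The analytic input is that \<open>\<beta>A\<inverse> + \<alpha>B\<inverse>\<close> is invertible, so that \<open>H\<close> really is its inverse.
  Invertibility is not additive, but for positive operators it is equivalent to
  coercivity (\<open>strictly_positive_op_coercive\<close>, \<open>coercive_imp_invertible\<close>), and lower bounds add.
\<close>

section \<open>Inner products and self-adjointness\<close>

lemma cinner_add_right: "cinner x (y + z) = cinner x y + cinner x z"
  by (metis cinner_add_left cinner_commute complex_cnj_add)

lemma cinner_scaleC_right: "cinner x (c *\<^sub>C y) = cnj c * cinner x y"
  by (metis cinner_commute cinner_scaleC_left complex_cnj_mult)

lemma cinner_scaleR_left: "cinner (r *\<^sub>R x) y = complex_of_real r * cinner x y"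
  by (simp add: scaleR_eq_scaleC cinner_scaleC_left)

lemma cinner_scaleR_right: "cinner x (r *\<^sub>R y) = complex_of_real r * cinner x y"
  by (simp add: scaleR_eq_scaleC cinner_scaleC_right)

lemma cinner_minus_left: "cinner (- x) y = - cinner x y"
  using cinner_scaleR_left[of "-1" x y] by simp

lemma cinner_minus_right: "cinner x (- y) = - cinner x y"
  using cinner_scaleR_right[of x "-1" y] by simp

lemma cinner_diff_left: "cinner (x - y) z = cinner x z - cinner y z"
  using cinner_add_left[of x "- y" z] by (simp add: cinner_minus_left)

lemma cinner_diff_right: "cinner x (y - z) = cinner x y - cinner x z"
  using cinner_add_right[of x y "- z"] by (simp add: cinner_minus_right)

lemmas cinner_linear = cinner_add_left cinner_add_right cinner_diff_left cinner_diff_right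
  cinner_scaleR_left cinner_scaleR_right cinner_minus_left cinner_minus_right

lemma Re_cinner_self: "Re (cinner x x) = (norm x)\<^sup>2"
  using cinner_self_nonneg[of x]
  by (simp add: norm_eq_sqrt_cinner complex_nonneg_Reals_iff)

lemma Re_cinner_commute: "Re (cinner x y) = Re (cinner y x)"
  by (metis cinner_commute complex_cnj(1) complex.exhaust_sel complex.sel(1))

lemma norm_add_sq: "(norm (x + y))\<^sup>2 = (norm x)\<^sup>2 + 2 * Re (cinner x y) + (norm y)\<^sup>2"
  for x y :: "'a::complex_inner"
  by (simp add: Re_cinner_self[symmetric] cinner_linear Re_cinner_commute[of y x])

lemma Re_cinner_le_norm: "Re (cinner x y) \<le> norm x * norm y"
proof -
  have "(norm (x + y))\<^sup>2 \<le> (norm x + norm y)\<^sup>2"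
    by (intro power_mono norm_triangle_ineq) simp
  then show ?thesis
    by (simp add: norm_add_sq power2_sum)
qed

text \<open>
  Over the complex numbers a quadratic form with real values determines a Hermitian sesquilinear
  form: the values at \<open>x + y\<close> and \<open>x + \<i>y\<close> control the imaginary and real part of
  \<open>\<langle>Tx, y\<rangle> - \<langle>x, Ty\<rangle>\<close>.
\<close>

lemma positive_op_self_adjoint:
  assumes "is_operator T" and "positive_op T"
  shows "cinner (T x) y = cinner x (T y)"
proof -
  have real: "Im (cinner (T u) u) = 0" for u
    using assms(2) by (simp add: positive_op_def complex_nonneg_Reals_iff)
  have "Im (cinner (T x) y) = - Im (cinner (T y) x)"
    using real[of "x + y"] real[of x] real[of y]
    by (simp add: blinfun.add_right cinner_linear)
  moreover have "Re (cinner (T x) y) = Re (cinner (T y) x)"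
    using real[of "x + \<i> *\<^sub>C y"] real[of x] real[of y] assms(1)
    by (simp add: blinfun.add_right cinner_linear is_operator_def cinner_scaleC_left
        cinner_scaleC_right)
  ultimately have "cinner (T x) y = cnj (cinner (T y) x)"
    by (simp add: complex_eq_iff)
  then show ?thesis
    by (simp add: cinner_commute[symmetric])
qed


section \<open>Strictly positive operators and coercivity\<close>

lemma apply_inverse_op:
  assumes "invertible_op T"
  shows "T (inverse_op T x) = x" and "inverse_op T (T x) = x"
  using is_inverse_op_inverse_op[OF assms] unfolding is_inverse_op_def
  by (metis blinfun_apply_blinfun_compose blinfun_apply_id_blinfun)+

lemma is_operator_inverse_op: "invertible_op T \<Longrightarrow> is_operator (inverse_op T)"
  using is_inverse_op_inverse_op is_inverse_op_def by blast

definition coercive_op :: "('a::complex_inner \<Rightarrow>\<^sub>L 'a) \<Rightarrow> bool" where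
  "coercive_op T \<longleftrightarrow> (\<exists>c>0. \<forall>x. c * (norm x)\<^sup>2 \<le> Re (cinner (T x) x))"

text \<open>
  Positivity at \<open>x - tTx\<close> gives \<open>\<parallel>Tx\<parallel>\<^sup>2 \<le> N\<langle>Tx, x\<rangle>\<close> for \<open>N \<ge> \<parallel>T\<parallel>\<close> and \<open>t = 1/N\<close>, which turns the
  lower bound \<open>\<parallel>x\<parallel> \<le> \<parallel>T\<inverse>\<parallel>\<parallel>Tx\<parallel>\<close> into coercivity.
\<close>

lemma strictly_positive_op_coercive:
  assumes "is_operator T" and "strictly_positive_op T"
  shows "coercive_op T"
proof -
  have pos: "positive_op T" and inv: "invertible_op T"
    using assms(2) by (auto simp: strictly_positive_op_def)
  \<comment> \<open>Adding 1 keeps both constants nonzero on the trivial space.\<close>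
  define N where "N = norm T + 1"
  define K where "K = norm (inverse_op T) + 1"
  have "N > 0" "K > 0"
    by (simp_all add: N_def K_def add_nonneg_pos)
  have bound: "(norm (T x))\<^sup>2 \<le> N * Re (cinner (T x) x)" for x
  proof -
    let ?v = "T x"
    have "Re (cinner (T ?v) ?v) \<le> norm (T ?v) * norm ?v"
      by (rule Re_cinner_le_norm)
    also have "\<dots> \<le> (N * norm ?v) * norm ?v"
      using norm_blinfun[of T ?v]
      by (intro mult_right_mono) (auto simp: N_def distrib_right intro: add_increasing2)
    finally have up: "Re (cinner (T ?v) ?v) \<le> N * (norm ?v)\<^sup>2"
      by (simp add: power2_eq_square algebra_simps)
    have "0 \<le> Re (cinner (T (N *\<^sub>R x - ?v)) (N *\<^sub>R x - ?v))"
      using pos by (simp add: positive_op_def complex_nonneg_Reals_iff)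
    also have "\<dots> = N\<^sup>2 * Re (cinner ?v x) - 2 * N * (norm ?v)\<^sup>2 + Re (cinner (T ?v) ?v)"
      using positive_op_self_adjoint[OF assms(1) pos, of ?v x]
      by (simp add: blinfun.diff_right blinfun.scaleR_right cinner_linear Re_cinner_self
          power2_eq_square algebra_simps)
    also have "\<dots> \<le> N * (N * Re (cinner ?v x) - (norm ?v)\<^sup>2)"
      using up by (simp add: power2_eq_square algebra_simps)
    finally show ?thesis
      using \<open>N > 0\<close> by (simp add: zero_le_mult_iff)
  qed
  have "1 / (K\<^sup>2 * N) * (norm x)\<^sup>2 \<le> Re (cinner (T x) x)" for x
  proof -
    have "norm x \<le> norm (inverse_op T) * norm (T x)"
      using norm_blinfun[of "inverse_op T" "T x"] by (simp add: apply_inverse_op(2)[OF inv])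
    also have "\<dots> \<le> K * norm (T x)"
      by (intro mult_right_mono) (auto simp: K_def)
    finally have "(norm x)\<^sup>2 \<le> (K * norm (T x))\<^sup>2"
      by (intro power_mono) auto
    also have "\<dots> \<le> K\<^sup>2 * (N * Re (cinner (T x) x))"
      unfolding power_mult_distrib by (intro mult_left_mono bound) simp
    finally show ?thesis
      using \<open>N > 0\<close> \<open>K > 0\<close> by (simp add: field_simps)
  qed
  moreover have "1 / (K\<^sup>2 * N) > 0"
    using \<open>N > 0\<close> \<open>K > 0\<close> by simp
  ultimately show ?thesis
    unfolding coercive_op_def by blast
qed

text \<open>
  Solving \<open>Tx = y\<close> amounts to finding a fixed point of \<open>x \<mapsto> x + t(y - Tx)\<close>. By coercivity
  \<open>\<parallel>x - tTx\<parallel>\<^sup>2 \<le> (1 - 2tc + t\<^sup>2N\<^sup>2)\<parallel>x\<parallel>\<^sup>2\<close>, so this map is a contraction for \<open>t = c/N\<^sup>2\<close>.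
\<close>

lemma coercive_imp_surj:
  fixes T :: "'a::chilbert_space \<Rightarrow>\<^sub>L 'a"
  assumes "coercive_op T"
  shows "\<exists>x. T x = y"
proof -
  obtain c where "c > 0" and c: "\<And>x. c * (norm x)\<^sup>2 \<le> Re (cinner (T x) x)"
    using assms unfolding coercive_op_def by blast
  \<comment> \<open>Any bound above both \<open>\<parallel>T\<parallel>\<close> and \<open>c\<close> serves; the latter keeps \<open>1 - c\<^sup>2/N\<^sup>2\<close> nonnegative.\<close>
  define N where "N = norm T + c"
  define t where "t = c / N\<^sup>2"
  define q where "q = sqrt (1 - c\<^sup>2 / N\<^sup>2)"
  have "N \<ge> c" "N > 0"
    using \<open>c > 0\<close> by (auto simp: N_def add_nonneg_pos)
  have "t > 0"
    using \<open>c > 0\<close> \<open>N > 0\<close> by (simp add: t_def)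
  have "0 < c\<^sup>2 / N\<^sup>2" "c\<^sup>2 / N\<^sup>2 \<le> 1"
    using \<open>c > 0\<close> \<open>N \<ge> c\<close> by (auto intro: power_mono)
  then have q: "0 \<le> q" "q < 1" and q2: "q\<^sup>2 = 1 - c\<^sup>2 / N\<^sup>2"
    by (auto simp: q_def)
  have contr: "norm (x - t *\<^sub>R T x) \<le> q * norm x" for x
  proof -
    have "norm (T x) \<le> N * norm x"
      using norm_blinfun[of T x] \<open>c > 0\<close> mult_right_mono[of "norm T" N "norm x"]
      by (simp add: N_def)
    then have "(norm (T x))\<^sup>2 \<le> N\<^sup>2 * (norm x)\<^sup>2"
      by (metis norm_ge_zero power_mono power_mult_distrib)
    then have "t\<^sup>2 * (norm (T x))\<^sup>2 \<le> t\<^sup>2 * (N\<^sup>2 * (norm x)\<^sup>2)"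
      by (intro mult_left_mono) simp_all
    moreover have "2 * t * (c * (norm x)\<^sup>2) \<le> 2 * t * Re (cinner (T x) x)"
      using c[of x] \<open>t > 0\<close> by (intro mult_left_mono) auto
    moreover have "(norm (x - t *\<^sub>R T x))\<^sup>2
        = (norm x)\<^sup>2 - 2 * t * Re (cinner (T x) x) + t\<^sup>2 * (norm (T x))\<^sup>2"
      using norm_add_sq[of x "- t *\<^sub>R T x"]
      by (simp add: cinner_linear power_mult_distrib Re_cinner_commute[of x])
    ultimately have "(norm (x - t *\<^sub>R T x))\<^sup>2
        \<le> (norm x)\<^sup>2 - 2 * t * (c * (norm x)\<^sup>2) + t\<^sup>2 * (N\<^sup>2 * (norm x)\<^sup>2)"
      by linarith
    also have "\<dots> = (1 - 2 * t * c + t\<^sup>2 * N\<^sup>2) * (norm x)\<^sup>2"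
      by (simp add: algebra_simps)
    also have "1 - 2 * t * c + t\<^sup>2 * N\<^sup>2 = q\<^sup>2"
      unfolding q2 using \<open>N > 0\<close> by (simp add: t_def power2_eq_square field_simps)
    finally have "(norm (x - t *\<^sub>R T x))\<^sup>2 \<le> (q * norm x)\<^sup>2"
      by (simp add: power_mult_distrib)
    then show ?thesis
      using q(1) by (meson mult_nonneg_nonneg norm_ge_zero power2_le_imp_le)
  qed
  have "\<exists>!x. x + t *\<^sub>R (y - T x) = x"
  proof (rule banach_fix_type[OF q], intro allI)
    fix u v
    have diff: "(u + t *\<^sub>R (y - T u)) - (v + t *\<^sub>R (y - T v)) = (u - v) - t *\<^sub>R T (u - v)"
      by (simp add: blinfun.diff_right algebra_simps)
    show "dist (u + t *\<^sub>R (y - T u)) (v + t *\<^sub>R (y - T v)) \<le> q * dist u v"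
      unfolding dist_norm diff by (rule contr)
  qed
  then show ?thesis
    using \<open>t > 0\<close> by auto
qed

lemma coercive_imp_invertible:
  fixes T :: "'a::chilbert_space \<Rightarrow>\<^sub>L 'a"
  assumes "is_operator T" and "coercive_op T"
  shows "invertible_op T"
proof -
  obtain c where "c > 0" and c: "\<And>x. c * (norm x)\<^sup>2 \<le> Re (cinner (T x) x)"
    using assms(2) unfolding coercive_op_def by blast
  have below: "norm x \<le> norm (T x) * (1 / c)" for x
  proof -
    have "c * norm x * norm x \<le> norm (T x) * norm x"
      using c[of x] Re_cinner_le_norm[of "T x" x] by (simp add: power2_eq_square mult.assoc)
    then have "c * norm x \<le> norm (T x)"
      by (cases "x = 0") auto
    then show ?thesis
      using \<open>c > 0\<close> by (simp add: field_simps)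
  qed
  have inj: "x = y" if "T x = T y" for x y
    using below[of "x - y"] that by (simp add: blinfun.diff_right)
  obtain S where TS: "\<And>y. T (S y) = y"
    using coercive_imp_surj[OF assms(2)] by metis
  have bl: "bounded_linear S"
  proof (rule bounded_linear_intro)
    show "S (x + y) = S x + S y" for x y
      by (rule inj) (simp add: TS blinfun.add_right)
    show "S (r *\<^sub>R x) = r *\<^sub>R S x" for r x
      by (rule inj) (simp add: TS blinfun.scaleR_right)
    show "norm (S x) \<le> norm x * (1 / c)" for x
      using below[of "S x"] by (simp add: TS)
  qed
  have "S (T x) = x" for x
    by (rule inj) (simp add: TS)
  moreover have "S (k *\<^sub>C x) = k *\<^sub>C S x" for k x
    by (rule inj) (use assms(1) in \<open>simp add: TS is_operator_def\<close>)
  ultimately have "is_inverse_op T (Blinfun S)"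
    unfolding is_inverse_op_def is_operator_def
    by (auto intro!: blinfun_eqI simp: bounded_linear_Blinfun_apply[OF bl] TS)
  then show ?thesis
    unfolding invertible_op_def by blast
qed


section \<open>The cone of strictly positive operators\<close>

lemma is_operator_add: "is_operator S \<Longrightarrow> is_operator T \<Longrightarrow> is_operator (S + T)"
  by (simp add: is_operator_def blinfun.add_left scaleC_add_right)

lemma is_operator_scaleR: "is_operator T \<Longrightarrow> is_operator (r *\<^sub>R T)"
  by (simp add: is_operator_def blinfun.scaleR_left scaleR_eq_scaleC scaleC_scaleC mult.commute)

lemma of_real_mult_nonneg_Reals:
  assumes "0 \<le> r" and "z \<in> \<real>\<^sub>\<ge>\<^sub>0"
  shows "complex_of_real r * z \<in> \<real>\<^sub>\<ge>\<^sub>0"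
  using assms by (intro nonneg_Reals_mult_I) auto

lemma strictly_positive_op_inverse_op:
  assumes "is_operator T" and "strictly_positive_op T"
  shows "strictly_positive_op (inverse_op T)"
proof -
  have inv: "invertible_op T" and pos: "positive_op T"
    using assms(2) by (auto simp: strictly_positive_op_def)
  have "cinner (inverse_op T x) x \<in> \<real>\<^sub>\<ge>\<^sub>0" for x
  proof -
    have "cinner (T (inverse_op T x)) (inverse_op T x) \<in> \<real>\<^sub>\<ge>\<^sub>0"
      using pos unfolding positive_op_def by blast
    then have "cinner x (inverse_op T x) \<in> \<real>\<^sub>\<ge>\<^sub>0"
      by (simp add: apply_inverse_op(1)[OF inv])
    then show ?thesis
      using cinner_commute[of "inverse_op T x" x] by (simp add: complex_nonneg_Reals_iff)
  qed
  moreover have "invertible_op (inverse_op T)"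
    using is_inverse_op_inverse_op[OF inv] assms(1)
    unfolding invertible_op_def is_inverse_op_def by blast
  ultimately show ?thesis
    by (simp add: strictly_positive_op_def positive_op_def)
qed

text \<open>
  The two coercivity constants combine into one for the sum, and completeness turns coercivity back
  into invertibility.
\<close>

lemma invertible_op_positive_combination:
  fixes S T :: "'a::chilbert_space \<Rightarrow>\<^sub>L 'a"
  assumes "is_operator S" "is_operator T" "strictly_positive_op S" "strictly_positive_op T"
    and "0 < a" "0 < b"
  shows "invertible_op (a *\<^sub>R S + b *\<^sub>R T)"
proof (rule coercive_imp_invertible)
  show "is_operator (a *\<^sub>R S + b *\<^sub>R T)"
    using assms by (intro is_operator_add is_operator_scaleR)
  obtain c d where "c > 0" "d > 0"
    and c: "\<And>x. c * (norm x)\<^sup>2 \<le> Re (cinner (S x) x)"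
    and d: "\<And>x. d * (norm x)\<^sup>2 \<le> Re (cinner (T x) x)"
    using assms(1-4) strictly_positive_op_coercive unfolding coercive_op_def by meson
  have "(a * c + b * d) * (norm x)\<^sup>2 \<le> Re (cinner ((a *\<^sub>R S + b *\<^sub>R T) x) x)" for x
    using add_mono[OF mult_left_mono[OF c] mult_left_mono[OF d], of a b x x] \<open>0 < a\<close> \<open>0 < b\<close>
    by (simp add: blinfun.add_left blinfun.scaleR_left cinner_linear algebra_simps)
  moreover have "a * c + b * d > 0"
    using \<open>c > 0\<close> \<open>d > 0\<close> \<open>0 < a\<close> \<open>0 < b\<close> by (simp add: add_pos_pos)
  ultimately show "coercive_op (a *\<^sub>R S + b *\<^sub>R T)"
    unfolding coercive_op_def by blast
qed


section \<open>The harmonic mean as a minimum\<close>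

text \<open>
  At \<open>d = 0\<close> this gives the minimum of \<open>\<alpha>\<langle>Ax, x\<rangle> + (1 - \<alpha>)\<langle>By, y\<rangle>\<close> over the pairs with
  \<open>x - y = z\<close>, and the terms in \<open>d\<close> show that it is one. Since \<open>\<alpha>Ax\<^sub>0 = \<alpha>(1 - \<alpha>)w\<close> and
  \<open>(1 - \<alpha>)By\<^sub>0 = -\<alpha>(1 - \<alpha>)w\<close>, the cross terms cancel.
\<close>

lemma harmonic_mean_complete_square:
  fixes A B :: "'a::chilbert_space \<Rightarrow>\<^sub>L 'a" and \<alpha> :: real and z d :: 'a
  assumes A: "is_operator A" "strictly_positive_op A"
    and B: "is_operator B" "strictly_positive_op B"
    and \<alpha>: "0 < \<alpha>" "\<alpha> < 1"
  defines "w \<equiv> weighted_harmonic_mean \<alpha> A B z"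
  defines "x\<^sub>0 \<equiv> (1 - \<alpha>) *\<^sub>R inverse_op A w" and "y\<^sub>0 \<equiv> - (\<alpha> *\<^sub>R inverse_op B w)"
  shows "x\<^sub>0 - y\<^sub>0 = z"
    and "complex_of_real \<alpha> * cinner (A (x\<^sub>0 + d)) (x\<^sub>0 + d)
        + complex_of_real (1 - \<alpha>) * cinner (B (y\<^sub>0 + d)) (y\<^sub>0 + d)
      = complex_of_real (\<alpha> * (1 - \<alpha>)) * cinner w z
        + complex_of_real \<alpha> * cinner (A d) d + complex_of_real (1 - \<alpha>) * cinner (B d) d"
proof -
  let ?D = "(1 - \<alpha>) *\<^sub>R inverse_op A + \<alpha> *\<^sub>R inverse_op B"
  have inv: "invertible_op A" "invertible_op B" and pos: "positive_op A" "positive_op B"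
    using A B by (auto simp: strictly_positive_op_def)
  have "invertible_op ?D"
    using A B \<alpha> inv
    by (intro invertible_op_positive_combination is_operator_inverse_op
        strictly_positive_op_inverse_op) auto
  then have "?D w = z"
    by (simp add: w_def weighted_harmonic_mean_def apply_inverse_op)
  then show z: "x\<^sub>0 - y\<^sub>0 = z"
    by (simp add: x\<^sub>0_def y\<^sub>0_def blinfun.add_left blinfun.scaleR_left)
  have Ax: "A x\<^sub>0 = (1 - \<alpha>) *\<^sub>R w" and By: "B y\<^sub>0 = - (\<alpha> *\<^sub>R w)"
    by (simp_all add: x\<^sub>0_def y\<^sub>0_def blinfun.scaleR_right blinfun.minus_right
        apply_inverse_op(1)[OF inv(1)] apply_inverse_op(1)[OF inv(2)])
  have adj: "cinner (A d) x\<^sub>0 = complex_of_real (1 - \<alpha>) * cinner d w"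
    "cinner (B d) y\<^sub>0 = - (complex_of_real \<alpha> * cinner d w)"
    using positive_op_self_adjoint[OF A(1) pos(1), of d x\<^sub>0]
      positive_op_self_adjoint[OF B(1) pos(2), of d y\<^sub>0]
    by (simp_all add: Ax By cinner_linear)
  have zw: "cinner w z = cinner w x\<^sub>0 - cinner w y\<^sub>0"
    by (simp add: z[symmetric] cinner_linear)
  show "complex_of_real \<alpha> * cinner (A (x\<^sub>0 + d)) (x\<^sub>0 + d)
        + complex_of_real (1 - \<alpha>) * cinner (B (y\<^sub>0 + d)) (y\<^sub>0 + d)
      = complex_of_real (\<alpha> * (1 - \<alpha>)) * cinner w z
        + complex_of_real \<alpha> * cinner (A d) d + complex_of_real (1 - \<alpha>) * cinner (B d) d"
    by (simp add: blinfun.add_right cinner_linear Ax By adj zw algebra_simps)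
qed

text \<open>
  In the difference \<open>C\<close> has coefficient \<open>2\<alpha>(1 - \<alpha>) - \<alpha>(1 - \<alpha>) = \<alpha>(1 - \<alpha>)\<close> off the diagonal and
  \<open>-\<alpha>(1 - \<alpha>)\<close> on it, so its terms assemble into the form of \<open>C\<close> at \<open>x - y\<close>.
\<close>

lemma op_matrix_difference_form:
  fixes A B C :: "'a::complex_inner \<Rightarrow>\<^sub>L 'a" and \<alpha> :: real
  shows "cinner ((op_matrix (\<alpha> *\<^sub>R A) ((2 * \<alpha> * (1 - \<alpha>)) *\<^sub>R C) ((2 * \<alpha> * (1 - \<alpha>)) *\<^sub>R C)
        ((1 - \<alpha>) *\<^sub>R B) - (\<alpha> * (1 - \<alpha>)) *\<^sub>R op_matrix C C C C) (x, y)) (x, y)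
    = complex_of_real \<alpha> * cinner (A x) x + complex_of_real (1 - \<alpha>) * cinner (B y) y
      - complex_of_real (\<alpha> * (1 - \<alpha>)) * cinner (C (x - y)) (x - y)"
  by (simp add: blinfun.diff_left blinfun.scaleR_left op_matrix_apply cinner_prod_def
      cinner_linear blinfun.diff_right) algebra

theorem lemma2p10:
  fixes A B C :: "'a::chilbert_space \<Rightarrow>\<^sub>L 'a" and \<alpha> :: real
  assumes "is_operator A" and "is_operator B" and "is_operator C"
    and "strictly_positive_op A" and "strictly_positive_op B" and "strictly_positive_op C"
    and "0 < \<alpha>" and "\<alpha> < 1"
  shows "C \<preceq> weighted_harmonic_mean \<alpha> A B \<longleftrightarrow>
    (\<alpha> * (1 - \<alpha>)) *\<^sub>R op_matrix C C C C \<preceq>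
    op_matrix (\<alpha> *\<^sub>R A) ((2 * \<alpha> * (1 - \<alpha>)) *\<^sub>R C) ((2 * \<alpha> * (1 - \<alpha>)) *\<^sub>R C) ((1 - \<alpha>) *\<^sub>R B)"
    (is "_ \<longleftrightarrow> ?R \<preceq> ?L")
proof -
  let ?H = "weighted_harmonic_mean \<alpha> A B"
  define x\<^sub>0 where "x\<^sub>0 z = (1 - \<alpha>) *\<^sub>R inverse_op A (?H z)" for z
  define y\<^sub>0 where "y\<^sub>0 z = - (\<alpha> *\<^sub>R inverse_op B (?H z))" for z
  note square = harmonic_mean_complete_square[OF assms(1,4,2,5,7,8),
      folded x\<^sub>0_def y\<^sub>0_def]
  have form: "cinner ((?L - ?R) (x\<^sub>0 z + d, y\<^sub>0 z + d)) (x\<^sub>0 z + d, y\<^sub>0 z + d)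
      = complex_of_real (\<alpha> * (1 - \<alpha>)) * cinner ((?H - C) z) z
        + (complex_of_real \<alpha> * cinner (A d) d + complex_of_real (1 - \<alpha>) * cinner (B d) d)" for z d
  proof -
    have "(x\<^sub>0 z + d) - (y\<^sub>0 z + d) = z"
      using square(1)[of z] by simp
    then show ?thesis
      unfolding op_matrix_difference_form square(2)
      by (simp only: blinfun.diff_left cinner_diff_left right_diff_distrib) simp
  qed
  show ?thesis
  proof
    assume le: "C \<preceq> ?H"
    have "cinner ((?L - ?R) (x, y)) (x, y) \<in> \<real>\<^sub>\<ge>\<^sub>0" for x y
    proof -
      define d where "d = x - x\<^sub>0 (x - y)"
      have xy: "x = x\<^sub>0 (x - y) + d" "y = y\<^sub>0 (x - y) + d"
        using square(1)[of "x - y"] by (auto simp: d_def algebra_simps)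
      have "cinner ((?H - C) (x - y)) (x - y) \<in> \<real>\<^sub>\<ge>\<^sub>0"
        "cinner (A d) d \<in> \<real>\<^sub>\<ge>\<^sub>0" "cinner (B d) d \<in> \<real>\<^sub>\<ge>\<^sub>0"
        using le assms(4,5)
        by (auto simp: loewner_le_def strictly_positive_op_def positive_op_def)
      then have "cinner ((?L - ?R) (x\<^sub>0 (x - y) + d, y\<^sub>0 (x - y) + d))
          (x\<^sub>0 (x - y) + d, y\<^sub>0 (x - y) + d) \<in> \<real>\<^sub>\<ge>\<^sub>0"
        unfolding form using assms(7,8)
        by (intro nonneg_Reals_add_I of_real_mult_nonneg_Reals) auto
      then show ?thesis
        using xy by simp
    qed
    then show "?R \<preceq> ?L"
      by (auto simp: loewner_le_def positive_op_def)
  next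
    assume le: "?R \<preceq> ?L"
    \<comment> \<open>Evaluate the form at the minimising pair.\<close>
    have "complex_of_real (\<alpha> * (1 - \<alpha>)) * cinner ((?H - C) z) z \<in> \<real>\<^sub>\<ge>\<^sub>0" for z
    proof -
      have "cinner ((?L - ?R) (x\<^sub>0 z + 0, y\<^sub>0 z + 0)) (x\<^sub>0 z + 0, y\<^sub>0 z + 0) \<in> \<real>\<^sub>\<ge>\<^sub>0"
        using le by (simp only: loewner_le_def positive_op_def)
      then show ?thesis
        unfolding form using cinner_eq_zero_iff[of "0::'a"] by (simp del: of_real_mult)
    qed
    then have "cinner ((?H - C) z) z \<in> \<real>\<^sub>\<ge>\<^sub>0" for z
      using assms(7,8) of_real_mult_nonneg_Reals[of "1 / (\<alpha> * (1 - \<alpha>))"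
          "complex_of_real (\<alpha> * (1 - \<alpha>)) * cinner ((?H - C) z) z"]
      by simp
    then show "C \<preceq> ?H"
      by (simp add: loewner_le_def positive_op_def)
  qed
qed

end
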